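(* There is a universal constant $C>0$ such that the following holds for all integers $1\le\tau<T$ and every integer $M$ with $0\le M\le\frac{\tau}{3}$. For every (possibly randomized) algorithm $A$ for online learning with local permutations with permutation window of size $M$ and with all feedback delayed by exactly $\tau$ rounds, there exists a choice of linear, $1$-Lipschitz loss functions over $\mathcal{W}=[-1,1]\subset\mathbb{R}$ such that the expected regret of $A$ after $T$ rounds (with respect to the algorithm's randomness) satisfies $$\mathbb{E}\left[\sum_{t=1}^{T} f_t(w_t)-\sum_{t=1}^{T} f_t(w^* )\right]\ge C\sqrt{\tau T},\qquad\text{where } w^*\in\operatorname{argmin}_{w\in\mathcal{W}}\sum_{t=1}^T f_t(w);$$ that is, the expected regret is $\Omega(\sqrt{\tau T})$.
   Context: Online learning with local permutations and delayed feedback: an oblivious adversary fixes losses $h_1,\ldots,h_T:\mathcal{W}\to\mathbb{R}$. Before any loss is revealed, the algorithm chooses a (possibly random) permutation $\sigma$ of $\{1,\ldots,T\}$ with $|\sigma(t)-t|\le M$ for all $t$. It then faces the sequence $f_t=h_{\sigma^{-1}(t)}$, $t=1,\ldots,T$. At each round $t$ the algorithm picks $w_t\in\mathcal{W}$, suffers the loss $f_t(w_t)$, and then, at the end of round $t$, observes the function $f_{t-\tau}$ (and nothing if $t\le\tau$). Thus $w_t$ may depend only on the algorithm's internal randomness (including $\sigma$) and on $f_1,\ldots,f_{t-\tau-1}$. Linear functions on $[-1,1]$ are those of the form $w\mapsto\alpha w$ with $\alpha\in\mathbb{R}$. *)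

theory Defs
  imports "HOL-Probability.Probability" "HOL-Combinatorics.Permutations"
begin

definition local_perm :: "nat \<Rightarrow> nat \<Rightarrow> (nat \<Rightarrow> nat) \<Rightarrow> bool" where
  "local_perm M T \<sigma> \<longleftrightarrow>
     \<sigma> permutes {1..T} \<and> (\<forall>t\<in>{1..T}. \<bar>int (\<sigma> t) - int t\<bar> \<le> int M)"

text \<open>A deterministic strategy consists of a permutation and, for each round, a map from the
  list of losses observed so far to the point that is played.\<close>

type_synonym 'w strategy = "(nat \<Rightarrow> nat) \<times> (nat \<Rightarrow> ('w \<Rightarrow> real) list \<Rightarrow> 'w)"

definition presented_loss :: "(nat \<Rightarrow> nat) \<Rightarrow> (nat \<Rightarrow> 'w \<Rightarrow> real) \<Rightarrow> nat \<Rightarrow> 'w \<Rightarrow> real" where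
  "presented_loss \<sigma> h t = h (inv \<sigma> t)"

text \<open>At the end of round \<open>s\<close> the loss \<open>f (s - \<tau>)\<close> is revealed, provided \<open>s > \<tau>\<close>. Hence at the
  start of round \<open>t\<close> the losses \<open>f 1, \<dots>, f (t - \<tau> - 1)\<close> are known; by truncated
  subtraction the list is empty if \<open>t \<le> \<tau> + 1\<close>.\<close>

definition delayed_feedback :: "nat \<Rightarrow> (nat \<Rightarrow> 'w \<Rightarrow> real) \<Rightarrow> nat \<Rightarrow> ('w \<Rightarrow> real) list" where
  "delayed_feedback \<tau> f t = map f [1..<t - \<tau>]"

definition played_point ::
    "nat \<Rightarrow> (nat \<Rightarrow> 'w \<Rightarrow> real) \<Rightarrow> 'w strategy \<Rightarrow> nat \<Rightarrow> 'w" where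
  "played_point \<tau> h s t = snd s t (delayed_feedback \<tau> (presented_loss (fst s) h) t)"

definition regret ::
    "'w set \<Rightarrow> nat \<Rightarrow> nat \<Rightarrow> (nat \<Rightarrow> 'w \<Rightarrow> real) \<Rightarrow> 'w strategy \<Rightarrow> real" where
  "regret W \<tau> T h s =
     (let f = presented_loss (fst s) h;
          w_star = arg_min_on (\<lambda>w. \<Sum>t=1..T. f t w) W
      in (\<Sum>t=1..T. f t (played_point \<tau> h s t)) - (\<Sum>t=1..T. f t w_star))"

text \<open>A randomized algorithm is a random choice of a deterministic strategy. The joint
  distribution of the permutation and of the plays is arbitrary, so that a play may depend on
  the permutation and on all the internal randomness. By
  \<open>randomized_algorithm_of_random_seed\<close> below, internal randomness on an arbitrary
  probability space is covered; taking the strategies themselves as the sample space avoids a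
  type parameter on which a universal constant could depend.\<close>

definition randomized_algorithm ::
    "'w::topological_space set \<Rightarrow> nat \<Rightarrow> nat \<Rightarrow> 'w strategy measure \<Rightarrow> bool" where
  "randomized_algorithm W M T A \<longleftrightarrow>
     prob_space A \<and>
     fst \<in> measurable A (count_space UNIV) \<and>
     (\<forall>t\<in>{1..T}. \<forall>fs. (\<lambda>s. snd s t fs) \<in> borel_measurable A) \<and>
     (\<forall>s\<in>space A. local_perm M T (fst s) \<and> (\<forall>t\<in>{1..T}. \<forall>fs. snd s t fs \<in> W))"

definition expected_regret ::
    "'w set \<Rightarrow> nat \<Rightarrow> nat \<Rightarrow> 'w strategy measure \<Rightarrow> (nat \<Rightarrow> 'w \<Rightarrow> real) \<Rightarrow> real" where
  "expected_regret W \<tau> T A h = (\<integral>s. regret W \<tau> T h s \<partial>A)"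

lemma randomized_algorithm_of_random_seed:
  fixes Q :: "'a measure" and W :: "'w::topological_space set"
    and \<sigma> :: "'a \<Rightarrow> nat \<Rightarrow> nat" and w :: "'a \<Rightarrow> nat \<Rightarrow> ('w \<Rightarrow> real) list \<Rightarrow> 'w"
  assumes Q: "prob_space Q"
    and \<sigma>_meas: "\<sigma> \<in> measurable Q (count_space UNIV)"
    and w_meas: "\<And>t fs. t \<in> {1..T} \<Longrightarrow> (\<lambda>\<omega>. w \<omega> t fs) \<in> borel_measurable Q"
    and perm: "\<And>\<omega>. \<omega> \<in> space Q \<Longrightarrow> local_perm M T (\<sigma> \<omega>)"
    and w_in: "\<And>\<omega> t fs. \<omega> \<in> space Q \<Longrightarrow> t \<in> {1..T} \<Longrightarrow> w \<omega> t fs \<in> W"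
  shows "\<exists>A. randomized_algorithm W M T A \<and>
    (\<forall>\<tau> h. expected_regret W \<tau> T A h = (\<integral>\<omega>. regret W \<tau> T h (\<sigma> \<omega>, w \<omega>) \<partial>Q))"
proof -
  define X where "X \<omega> = (\<sigma> \<omega>, w \<omega>)" for \<omega>
  define S where "S = X ` space Q"
  define G where "G = {B. B \<subseteq> S \<and> X -` B \<inter> space Q \<in> sets Q}"
  define N where "N = sigma S G"
  have G_Pow: "G \<subseteq> Pow S"
    by (auto simp: G_def)
  have space_N: "space N = S"
    using G_Pow by (simp add: N_def)
  have X_meas: "X \<in> measurable Q N"
    unfolding N_def by (rule measurable_measure_of[OF G_Pow]) (auto simp: S_def G_def)
  have lift: "g \<in> measurable N K" if g: "(\<lambda>\<omega>. g (X \<omega>)) \<in> measurable Q K" for g and K :: "'b measure"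
  proof (rule measurableI)
    fix s assume "s \<in> space N"
    then show "g s \<in> space K"
      using measurable_space[OF g] by (auto simp: space_N S_def)
  next
    fix B assume "B \<in> sets K"
    then have "(\<lambda>\<omega>. g (X \<omega>)) -` B \<inter> space Q \<in> sets Q"
      using g by (rule measurable_sets[rotated])
    moreover have "X -` (g -` B \<inter> S) \<inter> space Q = (\<lambda>\<omega>. g (X \<omega>)) -` B \<inter> space Q"
      by (auto simp: S_def)
    ultimately have "g -` B \<inter> S \<in> G"
      by (simp add: G_def)
    then show "g -` B \<inter> space N \<in> sets N"
      using G_Pow by (auto simp: N_def)
  qed
  define A where "A = distr Q N X"
  have "randomized_algorithm W M T A"
    unfolding randomized_algorithm_def
  proof (intro conjI ballI allI)
    show "prob_space A"
      unfolding A_def using Q X_meas by (rule prob_space.prob_space_distr)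
    show "fst \<in> measurable A (count_space UNIV)"
      unfolding A_def measurable_distr_eq1 by (rule lift) (use \<sigma>_meas in \<open>simp add: X_def\<close>)
    show "(\<lambda>s. snd s t fs) \<in> borel_measurable A" if "t \<in> {1..T}" for t fs
      unfolding A_def measurable_distr_eq1
      by (rule lift) (use w_meas[OF that] in \<open>simp add: X_def\<close>)
  qed (use perm w_in in \<open>auto simp: A_def space_N S_def X_def\<close>)
  moreover have "expected_regret W \<tau> T A h = (\<integral>\<omega>. regret W \<tau> T h (\<sigma> \<omega>, w \<omega>) \<partial>Q)" for \<tau> h
  proof (cases "(\<lambda>\<omega>. regret W \<tau> T h (X \<omega>)) \<in> borel_measurable Q")
    case True
    then show ?thesis
      unfolding expected_regret_def A_def
      by (subst integral_distr[OF X_meas lift]) (simp_all add: X_def)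
  next
    case False
    then have "\<not> integrable Q (\<lambda>\<omega>. regret W \<tau> T h (X \<omega>))"
      by (blast dest: borel_measurable_integrable)
    moreover have "\<not> integrable A (regret W \<tau> T h)"
    proof
      assume "integrable A (regret W \<tau> T h)"
      then have "regret W \<tau> T h \<in> borel_measurable N"
        by (auto simp: A_def dest: borel_measurable_integrable)
      from measurable_compose[OF X_meas this] False show False
        by contradiction
    qed
    ultimately show ?thesis
      by (simp add: expected_regret_def not_integrable_integral_eq X_def)
  qed
  ultimately show ?thesis
    by blast
qed

text \<open>The comparator in \<open>regret\<close> is a genuine minimizer whenever the decision set is compact
  and nonempty and the losses are continuous on it.\<close>

lemma is_arg_min_comparator:
  fixes W :: "'w::topological_space set" and f :: "nat \<Rightarrow> 'w \<Rightarrow> real"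
  assumes "compact W" "W \<noteq> {}" "\<And>t. t \<in> {1..T} \<Longrightarrow> continuous_on W (f t)"
  shows "is_arg_min (\<lambda>w. \<Sum>t=1..T. f t w) (\<lambda>w. w \<in> W)
           (arg_min_on (\<lambda>w. \<Sum>t=1..T. f t w) W)"
proof -
  have "continuous_on W (\<lambda>w. \<Sum>t=1..T. f t w)"
    using assms(3) by (intro continuous_on_sum) auto
  from continuous_attains_inf[OF assms(1,2) this]
  have "\<exists>x. is_arg_min (\<lambda>w. \<Sum>t=1..T. f t w) (\<lambda>w. w \<in> W) x"
    by (auto simp: is_arg_min_linorder)
  then show ?thesis
    unfolding arg_min_on_def arg_min_def by (rule someI_ex)
qed

end

theory Submission
  imports Defs
begin

text \<open>
  Cut the time line into blocks of length \<open>b = \<tau> + 1 - 2 * M\<close> and let the losses of one block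
  share a uniformly random sign. A permutation with window \<open>M\<close> moves each loss by at most \<open>M\<close>,
  so any loss revealed before round \<open>t\<close> originally preceded the one suffered at round \<open>t\<close> by at
  least \<open>b\<close> positions, hence belongs to an earlier block. The point played is therefore independent
  of the sign that it is charged for, and the expected cumulative loss is \<open>0\<close>. The comparator gains
  \<open>b\<close> times the absolute value of a sum of about \<open>T / b\<close> independent signs, which is of order
  \<open>b * sqrt (T / b)\<close> on average, and \<open>b \<ge> \<tau> / 3\<close>.
\<close>

section \<open>Averages over sign vectors\<close>

text \<open>The extensional function space makes this set finite with \<open>2 ^ n\<close> elements,
  so expectations over uniform signs become finite, unnormalised sums.\<close>

definition sign_vectors :: "nat \<Rightarrow> (nat \<Rightarrow> real) set" where
  "sign_vectors n = {..<n} \<rightarrow>\<^sub>E {-1, 1}"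

lemma finite_sign_vectors [simp]: "finite (sign_vectors n)"
  unfolding sign_vectors_def by (intro finite_PiE) auto

lemma card_sign_vectors: "card (sign_vectors n) = 2 ^ n"
  unfolding sign_vectors_def by (subst card_PiE) (auto simp: numeral_2_eq_2)

lemma sign_vectors_cases: "e \<in> sign_vectors n \<Longrightarrow> j < n \<Longrightarrow> e j = -1 \<or> e j = 1"
  unfolding sign_vectors_def by (auto simp: PiE_iff)

text \<open>Conditioning on the last sign; this drives the inductions for the moments.\<close>

lemma sum_sign_vectors_Suc:
  "(\<Sum>e\<in>sign_vectors (Suc n). F e) = (\<Sum>e\<in>sign_vectors n. F (e(n := -1)) + F (e(n := 1)))"
proof -
  have inj: "inj_on (\<lambda>(y, e). e(n := y)) ({-1, 1} \<times> sign_vectors n)"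
    unfolding sign_vectors_def by (rule inj_combinator) simp
  have "sign_vectors (Suc n) = (\<lambda>(y, e). e(n := y)) ` ({-1, 1} \<times> sign_vectors n)"
    unfolding sign_vectors_def lessThan_Suc by (rule PiE_insert_eq)
  then have "(\<Sum>e\<in>sign_vectors (Suc n). F e)
      = (\<Sum>(y, e)\<in>{-1, 1} \<times> sign_vectors n. F (e(n := y)))"
    by (simp only: sum.reindex[OF inj]) (simp add: case_prod_unfold comp_def)
  also have "\<dots> = (\<Sum>y\<in>{-1, 1}. \<Sum>e\<in>sign_vectors n. F (e(n := y)))"
    by (simp add: sum.cartesian_product)
  finally show ?thesis
    by (simp add: sum.distrib)
qed

lemma sum_signs_upd: "(\<Sum>j<Suc n. (e(n := y)) j) = (\<Sum>j<n. e j) + y"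
  for e :: "nat \<Rightarrow> real"
  by simp

lemma second_moment_signs: "(\<Sum>e\<in>sign_vectors n. (\<Sum>j<n. e j)\<^sup>2) = 2 ^ n * real n"
proof (induction n)
  case (Suc n)
  have "(\<Sum>e\<in>sign_vectors (Suc n). (\<Sum>j<Suc n. e j)\<^sup>2)
      = (\<Sum>e\<in>sign_vectors n. 2 * (\<Sum>j<n. e j)\<^sup>2 + 2)"
    unfolding sum_sign_vectors_Suc sum_signs_upd
    by (intro sum.cong refl) (simp add: power2_eq_square algebra_simps)
  then show ?case
    by (simp add: sum.distrib card_sign_vectors Suc flip: sum_distrib_left) (simp add: algebra_simps)
qed simp

lemma fourth_moment_signs: "(\<Sum>e\<in>sign_vectors n. (\<Sum>j<n. e j) ^ 4) \<le> 2 ^ n * (3 * (real n)\<^sup>2)"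
proof (induction n)
  case (Suc n)
  have "(\<Sum>e\<in>sign_vectors (Suc n). (\<Sum>j<Suc n. e j) ^ 4)
      = (\<Sum>e\<in>sign_vectors n. 2 * (\<Sum>j<n. e j) ^ 4 + 12 * (\<Sum>j<n. e j)\<^sup>2 + 2)"
    unfolding sum_sign_vectors_Suc sum_signs_upd
    by (intro sum.cong refl) (simp add: power2_eq_square power4_eq_xxxx algebra_simps)
  also have "\<dots> = 2 * (\<Sum>e\<in>sign_vectors n. (\<Sum>j<n. e j) ^ 4) + 2 ^ n * (12 * real n + 2)"
    by (simp add: sum.distrib card_sign_vectors second_moment_signs flip: sum_distrib_left)
       (simp add: algebra_simps)
  also have "\<dots> \<le> 2 * (2 ^ n * (3 * (real n)\<^sup>2)) + 2 ^ n * (12 * real n + 2)"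
    using Suc by simp
  also have "\<dots> \<le> 2 ^ Suc n * (3 * (real (Suc n))\<^sup>2)"
    by (simp add: power2_eq_square algebra_simps)
  finally show ?case .
qed simp

text \<open>Bounds a first absolute moment below by the second and fourth moments. The coefficient
  \<open>4 / 27\<close> is the smallest possible: equality holds at
  \<open>\<bar>y\<bar> = 3 / 2\<close>, the double root in the factorization below.\<close>

lemma abs_ge_square_minus_fourth: "\<bar>y\<bar> \<ge> y\<^sup>2 - 4 / 27 * y ^ 4" for y :: real
proof -
  define z where "z = \<bar>y\<bar>"
  have "z - z\<^sup>2 + 4 / 27 * z ^ 4 = z * (z + 3) * (2 * z - 3)\<^sup>2 / 27"
    by (simp add: power2_eq_square power4_eq_xxxx algebra_simps)
  also have "\<dots> \<ge> 0"
    by (simp add: z_def)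
  finally have "z - z\<^sup>2 + 4 / 27 * z ^ 4 \<ge> 0" .
  moreover have "z\<^sup>2 = y\<^sup>2" "z ^ 4 = y ^ 4"
    by (simp_all add: z_def)
  ultimately show ?thesis
    by (simp add: z_def)
qed

text \<open>A Khintchine-type bound: averaging the previous inequality at the normalised sum, with
  second moment \<open>1\<close> and fourth moment at most \<open>3\<close>, gives
  \<open>1 - 3 * 4 / 27 = 5 / 9\<close>.\<close>

lemma sum_abs_signs_ge: "2 ^ n * (5 / 9 * sqrt n) \<le> (\<Sum>e\<in>sign_vectors n. \<bar>\<Sum>j<n. e j\<bar>)"
proof (cases "n = 0")
  case False
  define S where "S e = (\<Sum>j<n. e j)" for e :: "nat \<Rightarrow> real"
  have pos: "sqrt n > 0"
    using False by simp
  have sqrt4: "sqrt n ^ 4 = (real n)\<^sup>2"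
    by (simp add: power4_eq_xxxx power2_eq_square)
  have "2 ^ n * (5 / 9) = (2 ^ n * real n) / n - 4 / 27 * ((2 ^ n * (3 * (real n)\<^sup>2)) / (real n)\<^sup>2)"
    using False by simp
  also have "\<dots> \<le> (\<Sum>e\<in>sign_vectors n. (S e)\<^sup>2) / n
      - 4 / 27 * ((\<Sum>e\<in>sign_vectors n. S e ^ 4) / (real n)\<^sup>2)"
    unfolding S_def second_moment_signs
    by (intro diff_left_mono mult_left_mono divide_right_mono fourth_moment_signs) simp_all
  also have "\<dots> = (\<Sum>e\<in>sign_vectors n. (S e / sqrt n)\<^sup>2 - 4 / 27 * (S e / sqrt n) ^ 4)"
    by (simp add: sum_subtractf power_divide sqrt4 sum_divide_distrib sum_distrib_left)
  also have "\<dots> \<le> (\<Sum>e\<in>sign_vectors n. \<bar>S e / sqrt n\<bar>)"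
    by (intro sum_mono abs_ge_square_minus_fourth)
  also have "\<dots> = (\<Sum>e\<in>sign_vectors n. \<bar>S e\<bar>) / sqrt n"
    by (simp add: sum_divide_distrib)
  finally show ?thesis
    using pos by (simp add: S_def field_simps)
qed simp

text \<open>Flipping coordinate \<open>j\<close> is an involution of the sign vectors that negates
  every summand.\<close>

lemma sum_sign_times_invariant:
  assumes j: "j < n"
    and inv: "\<And>e. e \<in> sign_vectors n \<Longrightarrow> g (e(j := - e j)) = g e"
  shows "(\<Sum>e\<in>sign_vectors n. e j * g e) = 0"
proof -
  have flip_in: "e(j := - e j) \<in> sign_vectors n" if "e \<in> sign_vectors n" for e
    using that j by (auto simp: sign_vectors_def PiE_iff extensional_def)
  have "(\<Sum>e\<in>sign_vectors n. e j * g e)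
      = (\<Sum>e\<in>sign_vectors n. (e(j := - e j)) j * g (e(j := - e j)))"
    by (rule sum.reindex_bij_witness[where i="\<lambda>e. e(j := - e j)" and j="\<lambda>e. e(j := - e j)"])
       (auto simp: flip_in)
  also have "\<dots> = (\<Sum>e\<in>sign_vectors n. - (e j * g e))"
    by (intro sum.cong refl) (simp add: inv)
  finally show ?thesis
    by (simp add: sum_negf)
qed

section \<open>Regret of a strategy for linear losses\<close>

lemma local_perm_inv:
  assumes "local_perm M T \<sigma>" "t \<in> {1..T}"
  shows "inv \<sigma> t \<in> {1..T}" "t \<le> inv \<sigma> t + M" "inv \<sigma> t \<le> t + M"
proof -
  have perm: "\<sigma> permutes {1..T}"
    using assms by (simp add: local_perm_def)
  show mem: "inv \<sigma> t \<in> {1..T}"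
    using permutes_in_image[OF permutes_inv[OF perm]] assms(2) by blast
  then have "\<bar>int (\<sigma> (inv \<sigma> t)) - int (inv \<sigma> t)\<bar> \<le> int M"
    using assms(1) unfolding local_perm_def by blast
  then have "\<bar>int t - int (inv \<sigma> t)\<bar> \<le> int M"
    by (simp add: permutes_inverses(1)[OF perm])
  then show "t \<le> inv \<sigma> t + M" "inv \<sigma> t \<le> t + M"
    by linarith+
qed

lemma finite_local_perm: "finite {\<sigma>. local_perm M T \<sigma>}"
  by (rule finite_subset[OF _ finite_permutations[of "{1..T}"]]) (auto simp: local_perm_def)

lemma sum_presented_loss:
  assumes "local_perm M T \<sigma>"
  shows "(\<Sum>t=1..T. presented_loss \<sigma> h t w) = (\<Sum>i=1..T. h i w)"
proof -
  have "inv \<sigma> permutes {1..T}"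
    using assms by (simp add: local_perm_def permutes_inv)
  from sum.permute[OF this, of "\<lambda>i. h i w"] show ?thesis
    by (simp add: presented_loss_def comp_def)
qed

text \<open>The permutation does not change the total loss, which is a linear function of
  \<open>w\<close>; its minimum over the interval is attained at an endpoint.\<close>

lemma regret_linear:
  assumes perm: "local_perm M T (fst s)"
  shows "regret {-1..1} \<tau> T (\<lambda>i w. a i * w) s
    = (\<Sum>t=1..T. a (inv (fst s) t) * played_point \<tau> (\<lambda>i w. a i * w) s t) + \<bar>\<Sum>i=1..T. a i\<bar>"
proof -
  define f where "f = presented_loss (fst s) (\<lambda>i w. a i * w)"
  define L where "L = (\<Sum>i=1..T. a i)"
  define v where "v = arg_min_on (\<lambda>w. \<Sum>t=1..T. f t w) {-1..1}"
  have total: "(\<Sum>t=1..T. f t w) = L * w" for w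
    unfolding f_def L_def sum_presented_loss[OF perm] by (simp add: sum_distrib_right)
  have "is_arg_min (\<lambda>w. \<Sum>t=1..T. f t w) (\<lambda>w. w \<in> {-1..1}) v"
    unfolding v_def by (rule is_arg_min_comparator)
      (auto simp: f_def presented_loss_def intro!: continuous_intros)
  then have v: "v \<in> {-1..1}" and min: "\<And>w. w \<in> {-1..1} \<Longrightarrow> L * v \<le> L * w"
    unfolding is_arg_min_linorder total by auto
  have "\<bar>L * v\<bar> \<le> \<bar>L\<bar> * 1"
    unfolding abs_mult using v by (intro mult_left_mono) auto
  moreover have "L * v \<le> - \<bar>L\<bar>"
    using min[of 1] min[of "-1"] by auto
  ultimately have "L * v = - \<bar>L\<bar>"
    by linarith
  moreover have "regret {-1..1} \<tau> T (\<lambda>i w. a i * w) s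
      = (\<Sum>t=1..T. f t (played_point \<tau> (\<lambda>i w. a i * w) s t)) - (\<Sum>t=1..T. f t v)"
    unfolding regret_def Let_def f_def v_def ..
  ultimately show ?thesis
    unfolding total L_def by (simp add: f_def presented_loss_def)
qed

text \<open>Needed to exchange the expectation over the algorithm with the sum over sign
  vectors.\<close>

lemma integrable_regret_linear:
  fixes A :: "real strategy measure"
  assumes A: "randomized_algorithm {-1..1} M T A"
  shows "integrable A (regret {-1..1} \<tau> T (\<lambda>i w. a i * w))"
proof -
  interpret prob_space A
    using A by (simp add: randomized_algorithm_def)
  let ?P = "{\<sigma>. local_perm M T \<sigma>}" and ?h = "\<lambda>i w. a i * w"
  have fst_meas: "fst \<in> measurable A (count_space ?P)"
    by (rule measurable_count_space_extend[of _ UNIV])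
       (use A in \<open>auto simp: randomized_algorithm_def\<close>)
  have played_meas: "(\<lambda>s. snd s t fs) \<in> borel_measurable A" if "t \<in> {1..T}" for t fs
    using A that by (simp add: randomized_algorithm_def)
  \<comment> \<open>The feedback list depends on \<open>s\<close> only through its permutation. For
    each of the finitely many permutations the list is fixed, and the plays are measurable by
    assumption.\<close>
  have "(\<lambda>s. (\<lambda>\<sigma> s. \<Sum>t=1..T. a (inv \<sigma> t)
      * snd s t (delayed_feedback \<tau> (presented_loss \<sigma> ?h) t)) (fst s) s) \<in> borel_measurable A"
    by (rule measurable_compose_countable'[OF _ fst_meas])
       (auto intro!: borel_measurable_sum borel_measurable_times played_meas
         countable_finite finite_local_perm)
  then have "(\<lambda>s. (\<Sum>t=1..T. a (inv (fst s) t) * played_point \<tau> ?h s t) + \<bar>\<Sum>i=1..T. a i\<bar>)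
      \<in> borel_measurable A"
    by (intro borel_measurable_add) (simp_all add: played_point_def)
  then have meas: "regret {-1..1} \<tau> T ?h \<in> borel_measurable A"
    by (rule measurable_cong[THEN iffD2, rotated])
       (rule regret_linear[of M], use A in \<open>simp add: randomized_algorithm_def\<close>)
  show ?thesis
  proof (rule integrable_const_bound[OF _ meas])
    show "AE s in A. norm (regret {-1..1} \<tau> T ?h s) \<le> (\<Sum>i=1..T. \<bar>a i\<bar>) + \<bar>\<Sum>i=1..T. a i\<bar>"
    proof (rule AE_I2)
      fix s assume s: "s \<in> space A"
      then have perm: "local_perm M T (fst s)"
        using A by (auto simp: randomized_algorithm_def)
      have "\<bar>\<Sum>t=1..T. a (inv (fst s) t) * played_point \<tau> ?h s t\<bar>
          \<le> (\<Sum>t=1..T. \<bar>a (inv (fst s) t)\<bar>)"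
      proof (rule order_trans[OF sum_abs], rule sum_mono)
        fix t assume "t \<in> {1..T}"
        then have "played_point \<tau> ?h s t \<in> {-1..1}"
          using A s unfolding randomized_algorithm_def played_point_def by blast
        then have "\<bar>a (inv (fst s) t)\<bar> * \<bar>played_point \<tau> ?h s t\<bar> \<le> \<bar>a (inv (fst s) t)\<bar> * 1"
          by (intro mult_left_mono) auto
        then show "\<bar>a (inv (fst s) t) * played_point \<tau> ?h s t\<bar> \<le> \<bar>a (inv (fst s) t)\<bar>"
          by (simp add: abs_mult)
      qed
      also have "\<dots> = (\<Sum>i=1..T. \<bar>a i\<bar>)"
        using sum_presented_loss[OF perm, of "\<lambda>i _. \<bar>a i\<bar>" "0::real"]
        by (simp add: presented_loss_def)
      finally show "norm (regret {-1..1} \<tau> T ?h s) \<le> (\<Sum>i=1..T. \<bar>a i\<bar>) + \<bar>\<Sum>i=1..T. a i\<bar>"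
        unfolding regret_linear[OF perm] real_norm_def by linarith
    qed
  qed
qed

section \<open>Losses with one random sign per block\<close>

text \<open>Positions are counted from \<open>1\<close>; those after the last complete block get the zero loss.\<close>

definition block_sign :: "nat \<Rightarrow> nat \<Rightarrow> (nat \<Rightarrow> real) \<Rightarrow> nat \<Rightarrow> real" where
  "block_sign b N e i = (if (i - 1) div b < N then e ((i - 1) div b) else 0)"

lemma abs_block_sign_le: "e \<in> sign_vectors N \<Longrightarrow> \<bar>block_sign b N e i\<bar> \<le> 1"
  unfolding block_sign_def using sign_vectors_cases[of e N "(i - 1) div b"] by auto

lemma sum_block_sign:
  assumes "b > 0" "N * b \<le> T"
  shows "(\<Sum>i=1..T. block_sign b N e i) = b * (\<Sum>j<N. e j)"
proof -
  have "(\<Sum>i=1..T. block_sign b N e i) = (\<Sum>i<T. if i div b < N then e (i div b) else 0)"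
    by (rule sum.reindex_bij_witness[where i=Suc and j="\<lambda>i. i - 1"]) (auto simp: block_sign_def)
  also have "\<dots> = (\<Sum>i<N * b. e (i div b))"
    \<comment> \<open>Indices from \<open>N * b\<close> on lie beyond the last complete block and
      contribute \<open>0\<close>.\<close>
    using assms
    by (intro sum.mono_neutral_cong_right) (auto simp: less_mult_imp_div_less div_less_iff_less_mult)
  also have "\<dots> = (\<Sum>j<N. \<Sum>i=j * b..<j * b + b. e (i div b))"
    by (rule sum.nat_group[symmetric])
  also have "\<dots> = (\<Sum>j<N. \<Sum>i=j * b..<j * b + b. e j)"
  proof (intro sum.cong refl arg_cong[of _ _ e])
    fix i j assume "i \<in> {j * b..<j * b + b}"
    then show "i div b = j"
      by (intro div_nat_eqI) (auto simp: mult.commute)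
  qed
  also have "\<dots> = b * (\<Sum>j<N. e j)"
    by (simp add: sum_distrib_left)
  finally show ?thesis .
qed

text \<open>With the strategy fixed, flipping the sign charged at round \<open>t\<close> leaves the
  feedback, and so the play, unchanged.\<close>

lemma sum_block_sign_times_played_point:
  assumes perm: "local_perm M T (fst s)" and t: "t \<in> {1..T}"
    and b: "b > 0" "b + 2 * M \<le> \<tau> + 1"
  shows "(\<Sum>e\<in>sign_vectors N. block_sign b N e (inv (fst s) t)
    * played_point \<tau> (\<lambda>i w. block_sign b N e i * w) s t) = 0"
proof (cases "(inv (fst s) t - 1) div b < N")
  case True
  define j where "j = (inv (fst s) t - 1) div b"
  have "played_point \<tau> (\<lambda>i w. block_sign b N (e(j := - e j)) i * w) s t
      = played_point \<tau> (\<lambda>i w. block_sign b N e i * w) s t" for e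
  proof -
    have "block_sign b N (e(j := - e j)) (inv (fst s) r) = block_sign b N e (inv (fst s) r)"
      if r: "r \<in> set [1..<t - \<tau>]" for r
    proof -
      have r': "r \<in> {1..T}" "r < t - \<tau>"
        using r t by auto
      \<comment> \<open>Rounds \<open>r\<close> and \<open>t\<close> are at least
        \<open>\<tau> + 1\<close> apart, and each original position is off by at most
        \<open>M\<close>; the remaining gap \<open>\<tau> + 1 - 2 * M\<close> is at least
        \<open>b\<close>, a full block.\<close>
      then have "inv (fst s) r - 1 + b \<le> inv (fst s) t - 1"
        using b local_perm_inv[OF perm r'(1)] local_perm_inv[OF perm t] by auto
      then have "(inv (fst s) r - 1 + b) div b \<le> j"
        unfolding j_def by (rule div_le_mono)
      then have "(inv (fst s) r - 1) div b \<noteq> j"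
        using b by simp
      then show ?thesis
        by (simp add: block_sign_def)
    qed
    then have "delayed_feedback \<tau> (presented_loss (fst s)
          (\<lambda>i w. block_sign b N (e(j := - e j)) i * w)) t
        = delayed_feedback \<tau> (presented_loss (fst s) (\<lambda>i w. block_sign b N e i * w)) t"
      unfolding delayed_feedback_def presented_loss_def by (intro map_cong refl) simp
    then show ?thesis
      by (simp add: played_point_def)
  qed
  with True have "(\<Sum>e\<in>sign_vectors N. e j * played_point \<tau> (\<lambda>i w. block_sign b N e i * w) s t) = 0"
    by (intro sum_sign_times_invariant) (simp_all add: j_def)
  then show ?thesis
    using True by (simp add: block_sign_def[of _ _ _ "inv (fst s) t"] j_def)
qed (simp add: block_sign_def)

text \<open>The learner's losses cancel over the signs, leaving exactly the comparator's gain,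
  whatever the strategy.\<close>

lemma sum_regret_block_sign:
  assumes perm: "local_perm M T (fst s)"
    and b: "b > 0" "b + 2 * M \<le> \<tau> + 1" and N: "N * b \<le> T"
  shows "(\<Sum>e\<in>sign_vectors N. regret {-1..1} \<tau> T (\<lambda>i w. block_sign b N e i * w) s)
    = b * (\<Sum>e\<in>sign_vectors N. \<bar>\<Sum>j<N. e j\<bar>)"
proof -
  have "(\<Sum>e\<in>sign_vectors N. \<Sum>t=1..T. block_sign b N e (inv (fst s) t)
      * played_point \<tau> (\<lambda>i w. block_sign b N e i * w) s t) = 0"
    by (subst sum.swap)
       (intro sum.neutral ballI sum_block_sign_times_played_point[OF perm _ b])
  then show ?thesis
    unfolding regret_linear[OF perm] sum.distrib sum_block_sign[OF b(1) N]
    by (simp add: abs_mult flip: sum_distrib_left)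
qed

text \<open>Averaging argument: were every sign vector below the bound, so would be their mean,
  which is known exactly.\<close>

lemma exists_signs_expected_regret_ge:
  fixes A :: "real strategy measure"
  assumes A: "randomized_algorithm {-1..1} M T A"
    and b: "b > 0" "b + 2 * M \<le> \<tau> + 1" and N: "N * b \<le> T"
  shows "\<exists>e\<in>sign_vectors N. b * (5 / 9 * sqrt N)
    \<le> expected_regret {-1..1} \<tau> T A (\<lambda>i w. block_sign b N e i * w)"
proof (rule ccontr)
  let ?R = "\<lambda>e. regret {-1..1} \<tau> T (\<lambda>i w. block_sign b N e i * w)"
  interpret prob_space A
    using A by (simp add: randomized_algorithm_def)
  assume "\<not> ?thesis"
  \<comment> \<open>The strict inequality requires a nonempty index set, which the cardinality
    provides.\<close>
  then have "(\<Sum>e\<in>sign_vectors N. \<integral>s. ?R e s \<partial>A) < (\<Sum>e\<in>sign_vectors N. b * (5 / 9 * sqrt N))"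
    using card_sign_vectors[of N]
    by (intro sum_strict_mono) (auto simp: expected_regret_def not_le)
  also have "\<dots> = b * (2 ^ N * (5 / 9 * sqrt N))"
    by (simp add: card_sign_vectors)
  also have "\<dots> \<le> b * (\<Sum>e\<in>sign_vectors N. \<bar>\<Sum>j<N. e j\<bar>)"
    by (intro mult_left_mono sum_abs_signs_ge) simp
  also have "\<dots> = (\<integral>s. (\<Sum>e\<in>sign_vectors N. ?R e s) \<partial>A)"
  proof -
    have "(\<integral>s. (\<Sum>e\<in>sign_vectors N. ?R e s) \<partial>A)
        = (\<integral>s. b * (\<Sum>e\<in>sign_vectors N. \<bar>\<Sum>j<N. e j\<bar>) \<partial>A)"
      by (intro Bochner_Integration.integral_cong refl sum_regret_block_sign[OF _ b N])
         (use A in \<open>auto simp: randomized_algorithm_def\<close>)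
    then show ?thesis
      by (simp add: prob_space)
  qed
  also have "\<dots> = (\<Sum>e\<in>sign_vectors N. \<integral>s. ?R e s \<partial>A)"
    by (intro Bochner_Integration.integral_sum integrable_regret_linear[OF A])
  finally show False
    by simp
qed

section \<open>Block length, number of blocks and the universal constant\<close>

theorem theorem2:
  "\<exists>C>0. \<forall>(\<tau>::nat) (T::nat) (M::nat) (A :: real strategy measure).
     1 \<le> \<tau> \<and> \<tau> < T \<and> real M \<le> real \<tau> / 3 \<and>
     randomized_algorithm {-1..1} M T A \<longrightarrow>
     (\<exists>h :: nat \<Rightarrow> real \<Rightarrow> real.
        (\<forall>i\<in>{1..T}. linear (h i) \<and> 1-lipschitz_on {-1..1} (h i)) \<and>
        expected_regret {-1..1} \<tau> T A h \<ge> C * sqrt (real \<tau> * real T))"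
proof (intro exI[of _ "1 / 5 :: real"] conjI allI impI)
  fix \<tau> T M :: nat and A :: "real strategy measure"
  assume asm: "1 \<le> \<tau> \<and> \<tau> < T \<and> real M \<le> real \<tau> / 3 \<and> randomized_algorithm {-1..1} M T A"
  \<comment> \<open>The longest block that the gap argument allows;
    \<open>3 * M \<le> \<tau>\<close> keeps it of order \<open>\<tau>\<close>.\<close>
  define b where "b = \<tau> + 1 - 2 * M"
  define N where "N = T div b"
  have M: "3 * M \<le> \<tau>"
    using asm by linarith
  then have b: "b > 0" "b + 2 * M \<le> \<tau> + 1" "b \<le> T" "\<tau> \<le> 3 * b"
    using asm by (auto simp: b_def)
  have N: "N * b \<le> T"
    by (simp add: N_def)
  have "N \<ge> 1"
    using b by (simp add: N_def div_greater_zero_iff Suc_le_eq)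
  then have "1 * b \<le> N * b"
    by (rule mult_le_mono1)
  moreover have "T < N * b + b"
    using b by (simp add: N_def dividend_less_div_times add.commute)
  \<comment> \<open>The incomplete last block is shorter than \<open>b\<close>, so discarding it
    costs at most a factor \<open>2\<close>.\<close>
  ultimately have T: "T \<le> 2 * (N * b)"
    by linarith
  obtain e where e: "e \<in> sign_vectors N"
    and ge: "b * (5 / 9 * sqrt N) \<le> expected_regret {-1..1} \<tau> T A (\<lambda>i w. block_sign b N e i * w)"
    using exists_signs_expected_regret_ge[OF _ b(1,2) N] asm by blast
  have "\<tau> * T \<le> 3 * b * (2 * (N * b))"
    using b T by (intro mult_le_mono) auto
  then have "real (\<tau> * T) \<le> real (3 * b * (2 * (N * b)))"
    by (rule of_nat_mono)
  then have "real \<tau> * real T \<le> 6 * ((real b)\<^sup>2 * N)"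
    by (simp add: power2_eq_square mult_ac)
  \<comment> \<open>The square exceeds \<open>6\<close>, and \<open>1 / 5 * (25 / 9) = 5 / 9\<close>
    matches the constant of the averaging bound.\<close>
  also have "\<dots> \<le> (25 / 9)\<^sup>2 * ((real b)\<^sup>2 * N)"
    by (intro mult_right_mono) (simp_all add: power2_eq_square)
  finally have "sqrt (real \<tau> * real T) \<le> sqrt ((25 / 9)\<^sup>2 * ((real b)\<^sup>2 * N))"
    by (rule real_sqrt_le_mono)
  then have "1 / 5 * sqrt (real \<tau> * real T) \<le> b * (5 / 9 * sqrt N)"
    by (simp add: real_sqrt_mult)
  with ge have "1 / 5 * sqrt (real \<tau> * real T)
      \<le> expected_regret {-1..1} \<tau> T A (\<lambda>i w. block_sign b N e i * w)"
    by linarith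
  moreover have "1-lipschitz_on {-1..1} (\<lambda>w. block_sign b N e i * w)" for i
  proof (rule lipschitz_onI)
    fix x y :: real
    show "dist (block_sign b N e i * x) (block_sign b N e i * y) \<le> 1 * dist x y"
      using mult_right_mono[OF abs_block_sign_le[OF e, of b i], of "\<bar>x - y\<bar>"]
      by (simp add: dist_real_def abs_mult flip: right_diff_distrib)
  qed simp
  moreover have "linear (\<lambda>w. block_sign b N e i * w)" for i
    by (intro linearI) (simp_all add: algebra_simps)
  ultimately show "\<exists>h :: nat \<Rightarrow> real \<Rightarrow> real.
      (\<forall>i\<in>{1..T}. linear (h i) \<and> 1-lipschitz_on {-1..1} (h i)) \<and>
      expected_regret {-1..1} \<tau> T A h \<ge> 1 / 5 * sqrt (real \<tau> * real T)"
    by (intro exI[of _ "\<lambda>i w. block_sign b N e i * w"]) blast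
qed simp

end
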